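(* Let $q=p^n$ where $p$ is a prime with $p\equiv 3\pmod 4$ and $n$ is odd, and let $V=\mathbb{F}_q^3$ (column vectors, an additive group). Let $I=\mathbb{F}_q\cup\{\infty,\bullet\}$ and let $O_i$ ($i\in I$) be the subsets $O_i=\{(s(x^2/2+i),sx,s)^T\mid x\in\mathbb{F}_q,s\in\mathbb{F}_q^{*2}\}$ for $i\in\mathbb{F}_q$, $O_\infty=\{(x,s,0)^T\mid x\in\mathbb{F}_q,s\in\mathbb{F}_q^{*2}\}$, $O_\bullet=\{(s,0,0)^T\mid s\in\mathbb{F}_q^{*2}\}$, where $\mathbb{F}_q^{*2}$ is the set of nonzero squares. For a function $\varepsilon:I\to\{\pm1\}$ let $D_\varepsilon=\bigcup_{i\in I}\varepsilon(i)O_i$ and $J_\varepsilon=\{i\in\mathbb{F}_q\mid\varepsilon(i)=1\}$. Then $D_\varepsilon$ is a skew Hadamard difference set in $V$ if and only if there is $\mu\in\{1,-1\}$ with $|J_\varepsilon|=\frac{q+\mu}{2}$ and $\varepsilon(\bullet)=\left(\frac{2}{p}\right)\mu$, where $\left(\frac{2}{p}\right)$ is the Legendre symbol.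
   Context: A subset $D$ of a finite group $H$ is a difference set with parameters $(v,k,\lambda)$ if $|H|=v$, $|D|=k$ and every non-identity element of $H$ is expressible as $d_1d_2^{-1}$ ($d_1,d_2\in D$) in exactly $\lambda$ ways; it is a skew Hadamard difference set if moreover $H\setminus\{1_H\}=D\cup D^{(-1)}$ and $D\cap D^{(-1)}=\emptyset$ (in additive notation $D^{(-1)}=-D$). The sets $O_i,-O_i$ ($i\in I$) are exactly the nonzero orbits on $V$ of the group $A=\{sE(x)\mid s\in\mathbb{F}_q^{*2},x\in\mathbb{F}_q\}$, $E(x)=\begin{pmatrix}1&x&x^2/2\\0&1&x\\0&0&1\end{pmatrix}$, acting by left multiplication, so the sets $D_\varepsilon$ are exactly the candidate $A$-invariant skew Hadamard difference sets. *)

theory Defs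
  imports "HOL-Analysis.Analysis" "HOL-Number_Theory.Number_Theory"
begin

text \<open>Groups are written additively. The class \<^class>\<open>group_add\<close> does not assume
  commutativity; \<open>d1 - d2\<close> is \<open>d1 + (- d2)\<close>, that is, \<open>d1 d2\<^sup>-\<^sup>1\<close> in multiplicative notation.\<close>

definition difference_set :: "'h::{group_add,finite} set \<Rightarrow> nat \<Rightarrow> nat \<Rightarrow> nat \<Rightarrow> bool" where
  "difference_set D v k l \<longleftrightarrow>
     CARD('h) = v \<and> card D = k \<and>
     (\<forall>g::'h. g \<noteq> 0 \<longrightarrow> card {(d1, d2). d1 \<in> D \<and> d2 \<in> D \<and> d1 - d2 = g} = l)"

definition skew_Hadamard_difference_set :: "'h::{group_add,finite} set \<Rightarrow> bool" where
  "skew_Hadamard_difference_set D \<longleftrightarrow>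
     (\<exists>v k l. difference_set D v k l) \<and>
     UNIV - {0} = D \<union> uminus ` D \<and> D \<inter> uminus ` D = {}"

datatype 'a index = Fin 'a | Infty | Bullet

definition nonzero_squares :: "'a::field set" where
  "nonzero_squares = {s. s \<noteq> 0 \<and> (\<exists>t. s = t\<^sup>2)}"

text \<open>These sets and their negatives are the nonzero orbits on \<open>'a ^ 3\<close> of the matrices
  \<open>s E(x)\<close>, with \<open>s\<close> a nonzero square and \<open>E(x)\<close> having the rows
  \<open>(1, x, x\<^sup>2/2)\<close>, \<open>(0, 1, x)\<close>, \<open>(0, 0, 1)\<close>.\<close>

fun orbit :: "'a::field index \<Rightarrow> ('a ^ 3) set" where
  "orbit (Fin i) = {vector [s * (x\<^sup>2 / 2 + i), s * x, s] | x s. s \<in> nonzero_squares}"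
| "orbit Infty = {vector [x, s, 0] | x s. s \<in> nonzero_squares}"
| "orbit Bullet = {vector [s, 0, 0] | s. s \<in> nonzero_squares}"

definition D_set :: "('a::field index \<Rightarrow> int) \<Rightarrow> ('a ^ 3) set" where
  "D_set \<epsilon> = (\<Union>i. (\<lambda>w. of_int (\<epsilon> i) *s w) ` orbit i)"

definition J_set :: "('a index \<Rightarrow> int) \<Rightarrow> 'a set" where
  "J_set \<epsilon> = {i. \<epsilon> (Fin i) = 1}"

end

theory Submission
  imports Defs
begin

text \<open>Let \<open>f\<close> be \<open>1\<close> on \<open>D = D_set \<epsilon>\<close>, \<open>-1\<close> on \<open>- D\<close> and \<open>0\<close> at the origin. Then \<open>D\<close> is a skew Hadamard
  difference set iff the autocorrelation \<open>C\<close> of \<open>f\<close> is \<open>-1\<close> off the origin. Since \<open>f\<close> is homogeneous under the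
  quadratic character \<open>\<eta>\<close>, the sum of \<open>C\<close> over the hyperplane orthogonal to \<open>w\<close> is \<open>(T w)\<^sup>2 / (q - 1)\<close> with
  \<open>T w = (\<Sum>v. f v * \<eta> (w \<bullet> v))\<close>, a real substitute for the Fourier transform of \<open>f\<close>. As \<open>C\<close> is constant
  on punctured lines, its hyperplane sums determine it, and the condition becomes
  \<open>(T w)\<^sup>2 = (q - 1)\<^sup>2 q\<^sup>2\<close> for all \<open>w \<noteq> 0\<close>.

  With \<open>S = (\<Sum>i. \<epsilon> (Fin i))\<close> and \<open>w = (a, b, c)\<close>, summing \<open>\<eta>\<close> over the values of a quadratic polynomial
  gives \<open>T w = \<plusminus> (q - 1) (\<eta> 2 (q \<epsilon> (Fin d) - S) + \<epsilon> Bullet)\<close> if \<open>a \<noteq> 0\<close>, where \<open>d\<close> depends on \<open>w\<close> and takes all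
  values; \<open>T w = \<plusminus> (q - 1) q\<close> if \<open>a = 0 \<noteq> b\<close>; and \<open>T w = \<plusminus> (q - 1) q S\<close> if \<open>a = b = 0\<close>. So the condition is
  \<open>S = \<eta> 2 * \<epsilon> Bullet\<close>, where \<open>S = 2 |J| - q\<close>, and \<open>\<eta> 2\<close> is the Legendre symbol because \<open>n\<close> is odd.\<close>

section \<open>The quadratic character\<close>

definition quad_char :: "'a::field \<Rightarrow> int" where
  "quad_char x = (if x = 0 then 0 else if \<exists>y. x = y\<^sup>2 then 1 else -1)"

text \<open>Multiplication by \<open>x\<close> permutes the nonzero elements, so their product is
  unchanged by the factor \<open>x ^ (CARD('a) - 1)\<close> and cancels.\<close>

lemma power_card_minus_one_eq_1:
  fixes x :: "'a::{field,finite}"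
  assumes "x \<noteq> 0"
  shows "x ^ (CARD('a) - 1) = 1"
proof -
  have "(\<Prod>y\<in>UNIV-{0}. x * y) = \<Prod>(UNIV-{0})"
    by (rule prod.reindex_bij_witness[of _ "\<lambda>y. y / x" "\<lambda>y. x * y"]) (use assms in auto)
  then have "x ^ (CARD('a) - 1) * \<Prod>(UNIV-{0::'a}) = 1 * \<Prod>(UNIV-{0})"
    by (simp add: prod.distrib card_Diff_singleton)
  then show ?thesis
    by (subst (asm) mult_cancel_right) auto
qed

lemma of_nat_card_eq_0: "of_nat CARD('a) = (0 :: 'a::{ring_1,finite})"
  by (simp add: CHAR_dvd_CARD of_nat_eq_0_iff_char_dvd)

lemma sum_odd_eq_0:
  fixes f :: "'v::{finite,group_add} \<Rightarrow> int"
  assumes "\<And>v. f (- v) = - f v"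
  shows "(\<Sum>v\<in>UNIV. f v) = 0"
proof -
  have "(\<Sum>v\<in>UNIV. f v) = (\<Sum>v\<in>UNIV. - f v)"
    by (rule sum.reindex_bij_witness[of _ uminus uminus]) (auto simp: assms)
  then show ?thesis by (simp add: sum_negf)
qed

lemma quad_char_0 [simp]: "quad_char 0 = 0"
  by (simp add: quad_char_def)

lemma quad_char_eq_0_iff [simp]: "quad_char x = 0 \<longleftrightarrow> x = 0"
  by (simp add: quad_char_def)

lemma quad_char_square: "x \<noteq> 0 \<Longrightarrow> quad_char (x\<^sup>2) = 1"
  by (auto simp: quad_char_def)

lemma quad_char_1 [simp]: "quad_char 1 = 1"
  using quad_char_square[of 1] by simp

lemma quad_char_cases: "quad_char x \<in> {-1, 0, 1}"
  by (simp add: quad_char_def)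

lemma quad_char_mult_self: "quad_char x * quad_char x = (if x = 0 then 0 else 1)"
  by (simp add: quad_char_def)

lemma nonzero_squares_iff: "s \<in> nonzero_squares \<longleftrightarrow> quad_char s = 1"
  by (auto simp: nonzero_squares_def quad_char_def)

context
  assumes card_mod_4: "CARD('a::{field,finite}) mod 4 = 3"
begin

lemma two_neq_0: "(2::'a) \<noteq> 0"
proof
  assume *: "(2::'a) = 0"
  have "CARD('a) = 2 * (CARD('a) div 2) + 1"
    using card_mod_4 by presburger
  then have "(of_nat CARD('a) :: 'a) = 2 * of_nat (CARD('a) div 2) + 1"
    by (metis of_nat_1 of_nat_add of_nat_mult of_nat_numeral)
  then show False
    using * of_nat_card_eq_0[where 'a='a] by simp
qed

text \<open>Half of \<open>CARD('a) - 1\<close> is odd, so a square root \<open>y\<close> of -1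
  would satisfy \<open>y ^ (CARD('a) - 1) = -1\<close>, against the previous power identity.\<close>

lemma minus_one_neq_square: "y\<^sup>2 \<noteq> (-1 :: 'a)"
proof
  assume y: "y\<^sup>2 = (-1 :: 'a)"
  then have "y \<noteq> 0" by auto
  have e: "CARD('a) - 1 = 2 * (2 * (CARD('a) div 4) + 1)"
    using card_mod_4 by presburger
  have "(1::'a) = (y\<^sup>2) ^ (2 * (CARD('a) div 4) + 1)"
    using power_card_minus_one_eq_1[OF \<open>y \<noteq> 0\<close>] unfolding e power_mult by simp
  also have "\<dots> = -1"
    unfolding y by simp
  finally show False
    using two_neq_0 by (metis add.right_inverse one_add_one)
qed

text \<open>Write q - 1 = 2(2k + 1). Then \<open>x ^ (2 * k + 1)\<close> is a sign, and multiplying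
  it by \<open>x\<close> gives the explicit square \<open>(x ^ (k + 1))\<^sup>2\<close>. With the
  previous lemma this makes the character odd and multiplicative without any appeal to cyclicity of
  the unit group.\<close>

lemma square_or_minus_square:
  obtains y :: 'a where "x = y\<^sup>2 \<or> x = - (y\<^sup>2)"
proof (cases "x = 0")
  case True
  then show ?thesis using that[of 0] by simp
next
  case False
  define k where "k = CARD('a) div 4"
  have e: "CARD('a) - 1 = (2 * k + 1) * 2"
    using card_mod_4 unfolding k_def by presburger
  have "(x ^ (2 * k + 1))\<^sup>2 = 1"
    using power_card_minus_one_eq_1[OF False] unfolding e power_mult by simp
  then have "x ^ (2 * k + 1) = 1 \<or> x ^ (2 * k + 1) = -1"
    by (simp add: power2_eq_1_iff)
  moreover have "(k + 1) * 2 = Suc (2 * k + 1)"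
    by simp
  then have "(x ^ (k + 1))\<^sup>2 = x * x ^ (2 * k + 1)"
    by (metis power_Suc power_mult)
  ultimately have "x = (x ^ (k + 1))\<^sup>2 \<or> x = - ((x ^ (k + 1))\<^sup>2)"
    by auto
  then show ?thesis using that by blast
qed

lemma quad_char_minus: "quad_char (- x :: 'a) = - quad_char x"
proof -
  have "\<not> ((\<exists>y. x = y\<^sup>2) \<and> (\<exists>y. - x = y\<^sup>2))" if "x \<noteq> 0"
  proof
    assume "(\<exists>y. x = y\<^sup>2) \<and> (\<exists>y. - x = y\<^sup>2)"
    then obtain y z where "x = y\<^sup>2" "- x = z\<^sup>2" by auto
    then have "(z / y)\<^sup>2 = -1"
      using that by (simp add: power_divide field_simps)
    then show False using minus_one_neq_square by blast
  qed
  moreover have "(\<exists>y. x = y\<^sup>2) \<or> (\<exists>y. - x = y\<^sup>2)"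
    using square_or_minus_square[of x] by (metis minus_minus)
  ultimately show ?thesis by (auto simp: quad_char_def)
qed

lemma quad_char_square_mult: "t \<noteq> 0 \<Longrightarrow> quad_char (t\<^sup>2 * x :: 'a) = quad_char x"
proof -
  assume t: "t \<noteq> 0"
  have "(\<exists>y. t\<^sup>2 * x = y\<^sup>2) \<longleftrightarrow> (\<exists>y. x = y\<^sup>2)"
  proof
    assume "\<exists>y. t\<^sup>2 * x = y\<^sup>2"
    then obtain y where "t\<^sup>2 * x = y\<^sup>2" by auto
    then have "x = (y / t)\<^sup>2" using t by (simp add: power_divide field_simps)
    then show "\<exists>y. x = y\<^sup>2" ..
  qed (auto simp flip: power_mult_distrib)
  then show ?thesis using t by (simp add: quad_char_def)
qed

lemma quad_char_mult: "quad_char (x * y :: 'a) = quad_char x * quad_char y"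
proof (cases "x = 0")
  case False
  obtain t where t: "x = t\<^sup>2 \<or> x = - (t\<^sup>2)" using square_or_minus_square by blast
  with False have "t \<noteq> 0" by auto
  then show ?thesis
    using t quad_char_square_mult[of t y] quad_char_square[of t] by (auto simp: quad_char_minus)
qed simp

lemma quad_char_inverse: "quad_char (inverse x :: 'a) = quad_char x"
proof (cases "x = 0")
  case False
  then have "quad_char (inverse x) * (quad_char x * quad_char x) = quad_char (inverse x * x) * quad_char x"
    by (simp only: quad_char_mult mult.assoc)
  then show ?thesis using False by (simp add: quad_char_mult_self)
qed simp

lemma quad_char_divide: "quad_char (x / y :: 'a) = quad_char x * quad_char y"
  by (simp add: divide_inverse quad_char_mult quad_char_inverse)

lemma quad_char_of_int_sign:
  assumes "e \<in> {1, -1}"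
  shows "quad_char (of_int e :: 'a) = e"
  using assms by (auto simp: quad_char_minus)

section \<open>Character sums of linear and quadratic polynomials\<close>

lemma sum_quad_char: "(\<Sum>x\<in>UNIV. quad_char (x::'a)) = 0"
  by (rule sum_odd_eq_0) (rule quad_char_minus)

lemma sum_quad_char_affine:
  assumes "a \<noteq> (0::'a)"
  shows "(\<Sum>x\<in>UNIV. quad_char (a * x + b)) = 0"
proof -
  have "(\<Sum>x\<in>UNIV. quad_char (a * x + b)) = (\<Sum>x\<in>UNIV. quad_char (x::'a))"
    by (rule sum.reindex_bij_witness[of _ "\<lambda>x. (x - b) / a" "\<lambda>x. a * x + b"]) (use assms in auto)
  then show ?thesis by (simp add: sum_quad_char)
qed

lemma card_square_roots: "int (card {x::'a. x\<^sup>2 = y}) = 1 + quad_char y"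
proof (cases "\<exists>z. y = z\<^sup>2")
  case True
  then obtain z where z: "y = z\<^sup>2" by auto
  then have *: "{x. x\<^sup>2 = y} = {z, -z}" by (auto simp: power2_eq_iff)
  show ?thesis
  proof (cases "z = 0")
    case False
    have "z \<noteq> - z"
    proof
      assume "z = -z"
      then have "2 * z = 0" by (metis add.right_inverse mult_2)
      then show False using False two_neq_0 by simp
    qed
    then show ?thesis using False z * by (simp add: quad_char_square)
  qed (use z * in simp)
next
  case False
  then have "{x. x\<^sup>2 = y} = {}" by auto
  moreover from False have "y \<noteq> 0" by (metis zero_power2)
  ultimately show ?thesis using False by (simp add: quad_char_def)
qed

text \<open>Group the terms by the value of the square; the fibre over \<open>y\<close> has
  \<open>1 + quad_char y\<close> elements.\<close>

lemma sum_over_squares: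
  fixes g :: "'a \<Rightarrow> int"
  shows "(\<Sum>x\<in>UNIV. g (x\<^sup>2)) = (\<Sum>y\<in>UNIV. (1 + quad_char y) * g y)"
proof -
  have "(\<Sum>x\<in>UNIV. g (x\<^sup>2)) = (\<Sum>y\<in>UNIV. \<Sum>x\<in>{x\<in>UNIV. x\<^sup>2 = y}. g (x\<^sup>2))"
    by (rule sum.group[symmetric]) auto
  also have "\<dots> = (\<Sum>y\<in>UNIV. (1 + quad_char y) * g y)"
    by (intro sum.cong refl) (simp flip: card_square_roots)
  finally show ?thesis .
qed

lemma sum_quad_char_square_add:
  "(\<Sum>x\<in>UNIV. quad_char (x\<^sup>2 + t :: 'a)) = (if t = 0 then int CARD('a) - 1 else -1)"
proof (cases "t = 0")
  case True
  have "(\<Sum>x\<in>UNIV. quad_char (x\<^sup>2 :: 'a)) = (\<Sum>x\<in>UNIV-{0::'a}. 1)"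
    by (rule sum.mono_neutral_cong_right) (auto simp: quad_char_square)
  then show ?thesis using True by (simp add: of_nat_diff)
next
  case False
  have "(\<Sum>x\<in>UNIV. quad_char (x\<^sup>2 + t)) = (\<Sum>y\<in>UNIV. quad_char (1 * y + t))
      + (\<Sum>y\<in>UNIV. quad_char y * quad_char (y + t))"
    by (simp add: sum_over_squares[of "\<lambda>y. quad_char (y + t)"] distrib_right sum.distrib)
  also have "(\<Sum>y\<in>UNIV. quad_char (1 * y + t)) = 0"
    by (rule sum_quad_char_affine) simp
  also have "(\<Sum>y\<in>UNIV. quad_char y * quad_char (y + t))
      = (\<Sum>y\<in>UNIV-{0}. quad_char y * quad_char (y + t))"
    by (rule sum.mono_neutral_right) auto
  \<comment> \<open>Substitute z = (y + t)/y = 1 + t/y. As \<open>quad_char\<close> ignores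
    inversion, the summand becomes \<open>quad_char z\<close>, and z takes every value except
    1.\<close>
  also have "\<dots> = (\<Sum>z\<in>UNIV-{1::'a}. quad_char z)"
    by (rule sum.reindex_bij_witness[of _ "\<lambda>z. t / (z - 1)" "\<lambda>y. (y + t) / y"])
       (use False in \<open>auto simp: quad_char_divide divide_simps right_diff_distrib mult.commute\<close>)
  also have "\<dots> = -1"
    using sum_quad_char by (simp add: sum_diff1)
  finally show ?thesis using False by simp
qed

end

text \<open>A square root of 2 modulo p maps to one in the field. If 2 is a nonresidue, Euler's
  criterion with the odd exponent (p - 1)/2 makes -2 a residue, hence a square in the field, and
  then 2 is a nonsquare. Oddness of \<open>n\<close> gives the cardinality modulo 4.\<close>

lemma quad_char_two:
  assumes p: "prime p" "[p = 3] (mod 4)" and q: "CARD('a::{field,finite}) = p ^ n" "odd n"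
  shows "CARD('a) mod 4 = 3" and "quad_char (2::'a) = Legendre 2 (int p)"
proof -
  have "[p ^ n = 3 ^ n] (mod 4)"
    using p(2) by (rule cong_pow)
  moreover have "[(3::nat) ^ n = 3] (mod 4)"
  proof -
    obtain m where n: "n = 2 * m + 1" using q(2) oddE by blast
    have "[(9::nat) ^ m * 3 = 1 ^ m * 3] (mod 4)"
      by (intro cong_mult cong_pow) (auto simp: cong_def)
    moreover have "(3::nat) ^ n = 9 ^ m * 3"
      by (simp add: n power_mult)
    ultimately show ?thesis by simp
  qed
  ultimately show c4: "CARD('a) mod 4 = 3"
    using q(1) by (simp add: cong_def)
  have "(of_nat p :: 'a) ^ n = 0"
    using of_nat_card_eq_0[where 'a='a] q(1) by simp
  then have p0: "(of_nat p :: 'a) = 0" by simp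
  have cong: "(of_int a :: 'a) = of_int b" if "[a = b] (mod int p)" for a b
  proof -
    obtain k where "a = b + int p * k"
      using \<open>[a = b] (mod int p)\<close> by (metis cong_iff_lin cong_sym)
    then show ?thesis using p0 by simp
  qed
  have p_odd: "p mod 4 = 3" using p(2) by (simp add: cong_def)
  then have p2: "p > 2" by presburger
  have "\<not> int p dvd 2" using p2 zdvd_imp_le[of "int p" 2] by auto
  then have n0: "\<not> [2 = 0] (mod int p)" by (simp add: cong_0_iff)
  show "quad_char (2::'a) = Legendre 2 (int p)"
  proof (cases "QuadRes (int p) 2")
    case True
    then obtain y where "[y\<^sup>2 = 2] (mod int p)" by (auto simp: QuadRes_def)
    from cong[OF this] have y: "(2::'a) = (of_int y)\<^sup>2" by simp
    then have "(of_int y :: 'a) \<noteq> 0" using two_neq_0[OF c4] by auto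
    from quad_char_square[OF this] have "quad_char (2::'a) = 1"
      by (simp flip: y)
    then show ?thesis using True n0 by (simp add: Legendre_def)
  next
    case False
    then have L: "Legendre 2 (int p) = -1" using n0 by (simp add: Legendre_def)
    define k where "k = (p - 1) div 2"
    have "odd k" using p_odd unfolding k_def by presburger
    have "[-1 = 2 ^ k] (mod int p)"
      using euler_criterion[OF p(1) p2, of 2] L unfolding k_def by simp
    then have "[(-1) ^ k * (-1) = (-1) ^ k * 2 ^ k] (mod int p)"
      by (intro cong_mult) auto
    then have "[1 = (-2) ^ k] (mod int p)"
      using \<open>odd k\<close> by (simp flip: power_mult_distrib)
    moreover have "[Legendre (-2) (int p) = (-2) ^ k] (mod int p)"
      unfolding k_def by (rule euler_criterion[OF p(1) p2])
    ultimately have *: "[Legendre (-2) (int p) = 1] (mod int p)"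
      by (metis cong_sym cong_trans)
    \<comment> \<open>The other values 0 and -1 differ from 1 by 1 and 2, which the prime p > 2 does
      not divide.\<close>
    have "Legendre (-2) (int p) = 1"
    proof (rule ccontr)
      assume "Legendre (-2) (int p) \<noteq> 1"
      then have "Legendre (-2) (int p) = 0 \<or> Legendre (-2) (int p) = -1"
        by (auto simp: Legendre_def split: if_splits)
      then have "int p dvd 1 \<or> int p dvd 2"
        using * by (auto simp: cong_iff_dvd_diff)
      then show False using p2 zdvd_imp_le[of "int p" 1] zdvd_imp_le[of "int p" 2] by auto
    qed
    then obtain y where "[y\<^sup>2 = -2] (mod int p)"
      by (auto simp: Legendre_def QuadRes_def split: if_splits)
    from cong[OF this] have y: "(-2::'a) = (of_int y)\<^sup>2" by simp
    have "(of_int y :: 'a) \<noteq> 0" using y two_neq_0[OF c4] by auto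
    from quad_char_square[OF this] have "quad_char (- 2 :: 'a) = 1"
      unfolding y .
    then show ?thesis using L quad_char_minus[OF c4, of "2::'a"] by simp
  qed
qed

section \<open>Sums over the hyperplanes of a finite vector space\<close>

definition dot :: "'a::comm_ring_1 ^ 'n \<Rightarrow> 'a ^ 'n \<Rightarrow> 'a" where
  "dot w v = (\<Sum>i\<in>UNIV. w $ i * v $ i)"

lemma dot_commute: "dot w v = dot v w"
  by (simp add: dot_def mult.commute)

lemma dot_0_left [simp]: "dot 0 v = 0" and dot_0_right [simp]: "dot w 0 = 0"
  by (simp_all add: dot_def)

lemma dot_add_left: "dot (u + w) v = dot u v + dot w v"
  and dot_add_right: "dot w (u + v) = dot w u + dot w v"
  by (simp_all add: dot_def algebra_simps sum.distrib)

lemma dot_diff_left: "dot (u - w) v = dot u v - dot w v"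
  and dot_diff_right: "dot w (u - v) = dot w u - dot w v"
  and dot_minus_right: "dot w (- v) = - dot w v"
  by (simp_all add: dot_def algebra_simps sum_subtractf sum_negf)

lemma dot_scale_left: "dot (c *s w) v = c * dot w v"
  and dot_scale_right: "dot w (c *s v) = c * dot w v"
  by (simp_all add: dot_def sum_distrib_left ac_simps)

lemma dot_axis_left: "dot (axis i c) v = c * v $ i"
  by (simp add: dot_def axis_def if_distrib if_distribR sum.delta cong: if_cong)

lemma subspace_perp: "vec.subspace {w :: 'a::field ^ 'n. dot w g = 0}"
  by (simp add: vec.subspace_def dot_add_left dot_scale_left)

text \<open>The vector \<open>u\<close> spans a complement of the kernel of \<open>L\<close> in
  \<open>A\<close>: the coefficient of \<open>u\<close> in \<open>w\<close> must be
  \<open>L w / L u\<close>.\<close>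

lemma card_kernel:
  fixes L :: "'a::{field,finite} ^ 'n \<Rightarrow> 'a"
  assumes A: "vec.subspace A"
    and add: "\<And>x y. L (x + y) = L x + L y" and scale: "\<And>c x. L (c *s x) = c * L x"
    and u: "u \<in> A" "L u \<noteq> 0"
  shows "CARD('a) * card {w \<in> A. L w = 0} = card A"
proof -
  have diff: "L (x - y) = L x - L y" for x y
    using add[of "x - y" y] by simp
  have "bij_betw (\<lambda>(t, w). t *s u + w) (UNIV \<times> {w \<in> A. L w = 0}) A"
    by (rule bij_betw_byWitness[where f' = "\<lambda>w. (L w / L u, w - (L w / L u) *s u)"])
       (use u A in \<open>auto simp: add scale diff intro!: vec.subspace_add vec.subspace_diff vec.subspace_scale\<close>)
  from bij_betw_same_card[OF this] show ?thesis
    by (simp add: card_cartesian_product)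
qed

lemma card_perp:
  fixes g :: "'a::{field,finite} ^ 'n"
  assumes "g \<noteq> 0"
  shows "CARD('a) * card {w. dot w g = 0} = CARD('a) ^ CARD('n)"
proof -
  obtain i where "g $ i \<noteq> 0" using assms by (auto simp: vec_eq_iff)
  then show ?thesis
    using card_kernel[of UNIV "\<lambda>w. dot w g" "axis i 1"]
    by (simp add: dot_axis_left dot_add_left dot_scale_left vec.subspace_def)
qed

lemma card_perp_Int:
  fixes g h :: "'a::{field,finite} ^ 'n"
  assumes g: "g \<noteq> 0" and h: "h \<notin> range (\<lambda>c. c *s g)"
  shows "CARD('a) * (CARD('a) * card {w. dot w g = 0 \<and> dot w h = 0}) = CARD('a) ^ CARD('n)"
proof -
  obtain i where i: "g $ i \<noteq> 0" using g by (auto simp: vec_eq_iff)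
  have "h \<noteq> (h $ i / g $ i) *s g" using h by auto
  then obtain j where j: "h $ j \<noteq> (h $ i / g $ i) * g $ j" by (auto simp: vec_eq_iff)
  \<comment> \<open>A vector orthogonal to \<open>g\<close> by antisymmetry; its product with
    \<open>h\<close> is a 2x2 minor of \<open>g\<close> and \<open>h\<close>, nonzero by the choice
    of \<open>j\<close>.\<close>
  define u where "u = axis j (g $ i) - axis i (g $ j)"
  have "dot u g = 0"
    by (simp add: u_def dot_diff_left dot_axis_left)
  moreover have "dot u h \<noteq> 0"
    using i j by (simp add: u_def dot_diff_left dot_axis_left field_simps)
  ultimately show ?thesis
    using card_kernel[OF subspace_perp, of "\<lambda>w. dot w h" u g] card_perp[OF g]
    by (simp add: dot_add_left dot_scale_left)
qed

text \<open>Double counting: with q = \<open>CARD('a)\<close> and n = \<open>CARD('n)\<close>, a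
  vector \<open>h\<close> is orthogonal to q^(n-1) of the vectors \<open>w\<close> if it lies on the
  line of \<open>g\<close>, and to q^(n-2) otherwise. The factor q^2 avoids negative exponents. The
  value w = 0 is included and contributes the sum over the whole space. The formula serves to
  recover line sums from hyperplane sums.\<close>

lemma sum_hyperplanes_through:
  fixes C :: "'a::{field,finite} ^ 'n \<Rightarrow> int"
  assumes g: "g \<noteq> 0"
  shows "int CARD('a) ^ 2 * (\<Sum>w | dot w g = 0. \<Sum>h | dot w h = 0. C h)
    = int CARD('a) ^ CARD('n) * ((\<Sum>h\<in>UNIV. C h) + (int CARD('a) - 1) * (\<Sum>h\<in>range (\<lambda>c. c *s g). C h))"
proof -
  define q where "q = int CARD('a)"
  define N where "N h = int (card {w. dot w g = 0 \<and> dot w h = 0})" for h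
  have N: "q ^ 2 * N h = q ^ CARD('n) * (1 + (if h \<in> range (\<lambda>c. c *s g) then q - 1 else 0))" for h
  proof (cases "h \<in> range (\<lambda>c. c *s g)")
    case True
    then have "{w. dot w g = 0 \<and> dot w h = 0} = {w. dot w g = 0}"
      by (auto simp: dot_scale_right)
    moreover have "q * int (card {w. dot w g = 0}) = q ^ CARD('n)"
      unfolding q_def by (metis card_perp[OF g] of_nat_mult of_nat_power)
    ultimately show ?thesis using True by (simp add: N_def power2_eq_square)
  next
    case False
    then have "q * (q * N h) = q ^ CARD('n)"
      using arg_cong[OF card_perp_Int[OF g False], of int] by (simp add: q_def N_def)
    then show ?thesis using False by (simp add: power2_eq_square)
  qed
  have "(\<Sum>w | dot w g = 0. \<Sum>h | dot w h = 0. C h)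
      = (\<Sum>w | dot w g = 0. \<Sum>h\<in>UNIV. if dot w h = 0 then C h else 0)"
    by (intro sum.cong refl sum.mono_neutral_cong_left) auto
  also have "\<dots> = (\<Sum>h\<in>UNIV. \<Sum>w | dot w g = 0. if dot w h = 0 then C h else 0)"
    by (rule sum.swap)
  also have "\<dots> = (\<Sum>h\<in>UNIV. N h * C h)"
    by (intro sum.cong refl) (simp add: N_def sum.If_cases Collect_conj_eq)
  finally have "q ^ 2 * (\<Sum>w | dot w g = 0. \<Sum>h | dot w h = 0. C h)
      = (\<Sum>h\<in>UNIV. (q ^ 2 * N h) * C h)"
    by (simp add: sum_distrib_left mult.assoc)
  also have "\<dots> = (\<Sum>h\<in>UNIV. q ^ CARD('n) * (C h + (q - 1) * (if h \<in> range (\<lambda>c. c *s g) then C h else 0)))"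
    unfolding N by (intro sum.cong refl) (simp add: algebra_simps)
  also have "\<dots> = q ^ CARD('n) * ((\<Sum>h\<in>UNIV. C h) + (q - 1) * (\<Sum>h\<in>range (\<lambda>c. c *s g). C h))"
    by (simp only: sum.distrib sum_distrib_left[symmetric] sum.inter_restrict[OF finite, symmetric] Int_UNIV_left)
  finally show ?thesis unfolding q_def .
qed

section \<open>Autocorrelation of functions homogeneous under the quadratic character\<close>

lemma int_card_remove:
  assumes "finite S" "x \<in> S"
  shows "int (card (S - {x})) = int (card S) - 1"
  using card.remove[OF assms] by linarith

definition autocorrelation :: "('v::{finite,ab_group_add} \<Rightarrow> int) \<Rightarrow> 'v \<Rightarrow> int" where
  "autocorrelation f g = (\<Sum>v\<in>UNIV. f v * f (v + g))"

lemma sum_shift: "(\<Sum>v\<in>UNIV. f (v + g)) = (\<Sum>v\<in>UNIV. f (v :: 'v::{finite,ab_group_add}))"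
  by (rule sum.reindex_bij_witness[of _ "\<lambda>v. v - g" "\<lambda>v. v + g"]) auto

lemma sum_autocorrelation: "(\<Sum>g\<in>UNIV. autocorrelation f g) = (\<Sum>v\<in>UNIV. f v)\<^sup>2"
proof -
  have "(\<Sum>g\<in>UNIV. autocorrelation f g) = (\<Sum>v\<in>UNIV. f v * (\<Sum>g\<in>UNIV. f (v + g)))"
    unfolding autocorrelation_def by (subst sum.swap) (simp add: sum_distrib_left)
  also have "\<dots> = (\<Sum>v\<in>UNIV. f v)\<^sup>2"
    using sum_shift[of f]
    by (simp add: add.commute power2_eq_square flip: sum_distrib_right)
  finally show ?thesis .
qed

lemma sum_sign_function:
  fixes f :: "'v::{finite,zero} \<Rightarrow> int"
  assumes "\<And>v. v \<noteq> 0 \<Longrightarrow> f v \<in> {1, -1}" "f 0 = 0"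
  shows "(\<Sum>v\<in>UNIV. f v * f v) = int CARD('v) - 1"
proof -
  have "(\<Sum>v\<in>UNIV. f v * f v) = (\<Sum>v\<in>UNIV-{0::'v}. 1)"
    by (rule sum.mono_neutral_cong_right) (use assms in force)+
  then show ?thesis by (simp add: of_nat_diff)
qed

text \<open>Let \<open>n\<^sub>g\<close> be the number of ways to write \<open>g\<close> as a difference of elements of \<open>D\<close>. Expanding the
  indicator function of \<open>D\<close> as \<open>(f + 1 - \<delta>\<^sub>0) / 2\<close> gives \<open>4 n\<^sub>g = C(g) + v - 2\<close> with \<open>C\<close> the
  autocorrelation of \<open>f\<close>, and \<open>C\<close> sums to \<open>0\<close>, so its only possible constant value off \<open>0\<close> is \<open>-1\<close>.\<close>
lemma skew_Hadamard_iff_autocorrelation: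
  fixes f :: "'v::{finite,ab_group_add} \<Rightarrow> int"
  assumes sign: "\<And>v. v \<noteq> 0 \<Longrightarrow> f v \<in> {1, -1}" and odd: "\<And>v. f (- v) = - f v"
    and card: "CARD('v) mod 4 = 3"
  shows "skew_Hadamard_difference_set {v. f v = 1} \<longleftrightarrow> (\<forall>g. g \<noteq> 0 \<longrightarrow> autocorrelation f g = -1)"
proof -
  define D where "D = {v. f v = 1}"
  have f0: "f 0 = 0" using odd[of 0] by simp
  have uminus_D: "uminus ` D = {v. f v = -1}"
  proof (rule equalityI; rule subsetI)
    fix v assume "v \<in> {v. f v = -1}"
    then have "- v \<in> D" by (simp add: D_def odd)
    then show "v \<in> uminus ` D" by (rule image_eqI[rotated]) simp
  qed (auto simp: D_def odd)
  have partition: "UNIV - {0} = D \<union> uminus ` D" "D \<inter> uminus ` D = {}"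
    unfolding uminus_D using sign f0 by (auto simp: D_def)
  define n where "n g = card {(d1, d2). d1 \<in> D \<and> d2 \<in> D \<and> d1 - d2 = g}" for g
  define ind where "ind v = (f v + 1 - (if v = 0 then 1 else 0))" for v
  have sum0: "(\<Sum>v\<in>UNIV. f v) = 0"
    using odd by (rule sum_odd_eq_0)
  have n: "4 * int (n g) = autocorrelation f g + int CARD('v) - 2" if g: "g \<noteq> 0" for g
  proof -
    have ind: "ind v = (if v \<in> D then 2 else 0)" for v
      using sign[of v] f0 by (auto simp: ind_def D_def)
    have "n g = card {v. v \<in> D \<and> v + g \<in> D}"
      unfolding n_def
      by (rule bij_betw_same_card, rule bij_betw_byWitness[where f = snd and f' = "\<lambda>v. (v + g, v)"])
         (auto simp: diff_eq_eq add.commute)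
    then have "4 * int (n g) = (\<Sum>v | v \<in> D \<and> v + g \<in> D. 4)"
      by simp
    also have "\<dots> = (\<Sum>v\<in>UNIV. ind v * ind (v + g))"
      by (rule sum.mono_neutral_cong_left) (auto simp: ind)
    \<comment> \<open>The corrections at v = 0 and v = -g do not overlap since \<open>g\<close> is
      nonzero. They add up to 2 because \<open>f g\<close> and \<open>f (- g)\<close>
      cancel.\<close>
    also have "\<dots> = (\<Sum>v\<in>UNIV. f v * f (v + g) + f v + f (v + g) + 1 - (if v = 0 then 1 + f g else 0)
        - (if v = - g then 1 + f (- g) else 0))"
      using g by (intro sum.cong refl) (auto simp: ind_def f0 algebra_simps add_eq_0_iff)
    also have "\<dots> = autocorrelation f g + int CARD('v) - 2"
      using sum_shift[of f g] sum0 odd[of g]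
      by (simp add: sum.distrib sum_subtractf autocorrelation_def)
    finally show ?thesis .
  qed
  have total: "autocorrelation f 0 + (\<Sum>g\<in>UNIV-{0}. autocorrelation f g) = 0"
    using sum_autocorrelation[of f] sum0 by (simp add: sum.remove[of UNIV 0])
  have "autocorrelation f 0 = int CARD('v) - 1"
    using sum_sign_function[of f] sign f0 by (simp add: autocorrelation_def)
  note total = total[unfolded this]
  have D_iff: "skew_Hadamard_difference_set D \<longleftrightarrow> (\<exists>l. \<forall>g. g \<noteq> 0 \<longrightarrow> n g = l)"
    using partition unfolding skew_Hadamard_difference_set_def difference_set_def n_def by auto
  show ?thesis unfolding D_def[symmetric] D_iff
  proof
    assume "\<exists>l. \<forall>g. g \<noteq> 0 \<longrightarrow> n g = l"
    then obtain l where l: "\<And>g. g \<noteq> 0 \<Longrightarrow> n g = l" by auto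
    define c where "c = 4 * int l - int CARD('v) + 2"
    have c: "autocorrelation f g = c" if "g \<noteq> 0" for g
      using n[OF that] l[OF that] unfolding c_def by simp
    have "(int CARD('v) - 1) * (1 + c) = 0"
      using total c by (simp add: algebra_simps of_nat_diff)
    moreover have "int CARD('v) - 1 \<noteq> 0" using card by auto
    ultimately show "\<forall>g. g \<noteq> 0 \<longrightarrow> autocorrelation f g = -1" using c by auto
  next
    assume *: "\<forall>g. g \<noteq> 0 \<longrightarrow> autocorrelation f g = -1"
    have "n g = (CARD('v) - 3) div 4" if "g \<noteq> 0" for g
      using n[OF that] * that by force
    then show "\<exists>l. \<forall>g. g \<noteq> 0 \<longrightarrow> n g = l" by blast
  qed
qed

section \<open>Homogeneous functions and their transform over hyperplanes\<close>

context
  fixes f :: "'a::{field,finite} ^ 'n \<Rightarrow> int" and T :: "'a ^ 'n \<Rightarrow> int"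
  assumes card_mod_4: "CARD('a) mod 4 = 3"
    and homogeneous: "\<And>t v. f (t *s v) = quad_char t * f v"
  defines "T w \<equiv> \<Sum>v\<in>UNIV. f v * quad_char (dot w v)"
begin

lemma homogeneous_0: "f 0 = 0"
  using homogeneous[of 0 0] by simp

lemma homogeneous_minus: "f (- v) = - f v"
  using homogeneous[of "-1" v] by (simp add: quad_char_minus[OF card_mod_4])

lemma sum_homogeneous: "(\<Sum>v\<in>UNIV. f v) = 0"
  by (rule sum_odd_eq_0) (rule homogeneous_minus)

lemma autocorrelation_scale:
  assumes "t \<noteq> 0"
  shows "autocorrelation f (t *s g) = autocorrelation f g"
proof -
  have "autocorrelation f (t *s g) = (\<Sum>v\<in>UNIV. f (t *s v) * f (t *s v + t *s g))"
    unfolding autocorrelation_def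
    by (rule sum.reindex_bij_witness[of _ "\<lambda>v. t *s v" "\<lambda>v. inverse t *s v"])
       (use assms in \<open>auto simp: vector_smult_assoc\<close>)
  also have "\<dots> = (\<Sum>v\<in>UNIV. (quad_char t * quad_char t) * (f v * f (v + g)))"
    by (simp add: homogeneous ac_simps flip: vector_add_ldistrib)
  finally show ?thesis
    using assms by (simp add: autocorrelation_def quad_char_mult_self)
qed

text \<open>The sum of \<open>f\<close> over \<open>{v. dot w v = t}\<close> is \<open>quad_char t\<close> times its sum over
  \<open>{v. dot w v = 1}\<close>; both sides below are multiples of the square of the latter.\<close>
lemma sum_autocorrelation_hyperplane:
  "(int CARD('a) - 1) * (\<Sum>g | dot w g = 0. autocorrelation f g) = (T w)\<^sup>2"
proof -
  define F where "F t = (\<Sum>v | dot w v = t. f v)" for t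
  have F: "F t = quad_char t * F 1" for t
  proof (cases "t = 0")
    case True
    have "F 0 = (\<Sum>v | dot w v = 0. - f v)" unfolding F_def
      by (rule sum.reindex_bij_witness[of _ uminus uminus]) (auto simp: homogeneous_minus dot_minus_right)
    then have "F 0 = - F 0" by (simp add: F_def sum_negf)
    then show ?thesis using True by simp
  next
    case False
    have "F t = (\<Sum>v | dot w v = 1. f (t *s v))" unfolding F_def
      by (rule sum.reindex_bij_witness[of _ "\<lambda>v. t *s v" "\<lambda>v. inverse t *s v"])
         (use False in \<open>auto simp: vector_smult_assoc dot_scale_right\<close>)
    then show ?thesis by (simp add: F_def homogeneous sum_distrib_left)
  qed
  have "T w = (\<Sum>t\<in>UNIV. \<Sum>v\<in>{v\<in>UNIV. dot w v = t}. f v * quad_char (dot w v))"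
    unfolding T_def by (rule sum.group[symmetric]) auto
  also have "\<dots> = (\<Sum>t\<in>UNIV. quad_char t * F t)"
    by (intro sum.cong refl) (simp add: F_def sum_distrib_left mult.commute)
  also have "\<dots> = (\<Sum>t\<in>UNIV. quad_char (t::'a) * quad_char t) * F 1"
    by (subst F) (simp add: sum_distrib_right mult.assoc)
  also have "(\<Sum>t\<in>UNIV. quad_char (t::'a) * quad_char t) = int CARD('a) - 1"
    by (rule sum_sign_function) (auto simp: quad_char_def)
  finally have T1: "T w = (int CARD('a) - 1) * F 1" .
  have "(\<Sum>g | dot w g = 0. autocorrelation f g) = (\<Sum>v\<in>UNIV. f v * (\<Sum>g | dot w g = 0. f (v + g)))"
    unfolding autocorrelation_def by (subst sum.swap) (simp add: sum_distrib_left)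
  also have "\<dots> = (\<Sum>v\<in>UNIV. f v * F (dot w v))"
  proof (intro sum.cong refl arg_cong2[of _ _ _ _ "(*)"])
    \<comment> \<open>The translate of the hyperplane by \<open>v\<close> is the level set of
      \<open>dot w\<close> through \<open>v\<close>.\<close>
    fix v show "(\<Sum>g | dot w g = 0. f (v + g)) = F (dot w v)" unfolding F_def
      by (rule sum.reindex_bij_witness[of _ "\<lambda>u. u - v" "\<lambda>g. v + g"])
         (auto simp: dot_add_right dot_diff_right)
  qed
  also have "\<dots> = T w * F 1"
    unfolding T_def by (subst F) (simp add: sum_distrib_right mult.assoc)
  finally show ?thesis by (simp add: T1 power2_eq_square)
qed

text \<open>With Q = q^n the autocorrelation is Q - 1 at 0, so the value -1 elsewhere makes every
  hyperplane sum Q - Q/q. Conversely these sums fix each line sum by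
  \<open>sum_hyperplanes_through\<close>, and a line sum fixes the value at \<open>g\<close> by
  \<open>autocorrelation_scale\<close>. The equation is multiplied by q to stay in the integers for
  every dimension.\<close>

theorem autocorrelation_eq_minus_one_iff:
  assumes sign: "\<And>v. v \<noteq> 0 \<Longrightarrow> f v \<in> {1, -1}"
  shows "(\<forall>g. g \<noteq> 0 \<longrightarrow> autocorrelation f g = -1) \<longleftrightarrow>
    (\<forall>w. w \<noteq> 0 \<longrightarrow> int CARD('a) * (T w)\<^sup>2 = (int CARD('a) - 1)\<^sup>2 * int CARD('a) ^ CARD('n))"
proof -
  define q Q where "q = int CARD('a)" and "Q = q ^ CARD('n)"
  have q3: "q \<ge> 3" using card_mod_4 unfolding q_def by (cases "CARD('a) \<ge> 3") auto
  have Q0: "Q \<noteq> 0" using q3 by (simp add: Q_def)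
  define H where "H w = (\<Sum>g | dot w g = 0. autocorrelation f g)" for w
  have H: "(q - 1) * H w = (T w)\<^sup>2" for w
    unfolding q_def H_def by (rule sum_autocorrelation_hyperplane)
  have C0: "autocorrelation f 0 = Q - 1"
    using sum_sign_function[of f] sign homogeneous_0 by (simp add: autocorrelation_def Q_def q_def)
  have perp: "q * int (card {w. dot w g = 0}) = Q" if "g \<noteq> 0" for g :: "'a ^ 'n"
    using card_perp[OF that] unfolding q_def Q_def by (metis of_nat_mult of_nat_power)
  have "(\<forall>g. g \<noteq> 0 \<longrightarrow> autocorrelation f g = -1) \<longleftrightarrow> (\<forall>w. w \<noteq> 0 \<longrightarrow> q * H w = (q - 1) * Q)"
  proof (intro iffI allI impI)
    fix w :: "'a ^ 'n"
    assume *: "\<forall>g. g \<noteq> 0 \<longrightarrow> autocorrelation f g = -1" and w: "w \<noteq> 0"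
    have "H w = autocorrelation f 0 + (\<Sum>g\<in>{g. dot w g = 0}-{0}. autocorrelation f g)"
      unfolding H_def by (rule sum.remove) auto
    also have "(\<Sum>g\<in>{g. dot w g = 0}-{0}. autocorrelation f g) = (\<Sum>g\<in>{g. dot w g = 0}-{0}. -1)"
      using * by (intro sum.cong) auto
    also have "\<dots> = 1 - int (card {g. dot g w = 0})"
      by (simp add: int_card_remove del: card_Diff_insert add: dot_commute[of w])
    finally have "H w = Q - int (card {g. dot g w = 0})"
      by (simp add: C0)
    then have "q * H w = q * Q - q * int (card {g. dot g w = 0})"
      by (simp add: right_diff_distrib)
    then show "q * H w = (q - 1) * Q"
      using perp[OF w] by (simp add: algebra_simps)
  next
    fix g :: "'a ^ 'n"
    assume *: "\<forall>w. w \<noteq> 0 \<longrightarrow> q * H w = (q - 1) * Q" and g: "g \<noteq> 0"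
    \<comment> \<open>The hypothesis speaks of nonzero \<open>w\<close> only; for w = 0 the sum runs
      over the whole space and vanishes.\<close>
    have H0: "H 0 = 0"
      by (simp add: H_def sum_autocorrelation sum_homogeneous)
    have "q * (\<Sum>w | dot w g = 0. H w) = (\<Sum>w | dot w g = 0. q * H w)"
      by (simp add: sum_distrib_left)
    also have "\<dots> = q * H 0 + (\<Sum>w\<in>{w. dot w g = 0}-{0}. q * H w)"
      by (rule sum.remove) auto
    also have "\<dots> = (\<Sum>w\<in>{w. dot w g = 0}-{0}. (q - 1) * Q)"
      using * by (simp add: H0)
    also have "\<dots> = (int (card {w. dot w g = 0}) - 1) * ((q - 1) * Q)"
      by (simp add: int_card_remove del: card_Diff_insert)
    finally have qS: "q * (\<Sum>w | dot w g = 0. H w) = (int (card {w. dot w g = 0}) - 1) * ((q - 1) * Q)" .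
    have "q\<^sup>2 * (\<Sum>w | dot w g = 0. H w) = q * (q * (\<Sum>w | dot w g = 0. H w))"
      by (simp only: power2_eq_square mult.assoc)
    also have "\<dots> = (q * int (card {w. dot w g = 0}) - q) * ((q - 1) * Q)"
      unfolding qS by (simp add: algebra_simps)
    also have "\<dots> = Q * ((q - 1) * (Q - q))"
      unfolding perp[OF g] by (simp only: ac_simps)
    finally have L: "q\<^sup>2 * (\<Sum>w | dot w g = 0. H w) = Q * ((q - 1) * (Q - q))" .
    have "(\<Sum>h\<in>range (\<lambda>c. c *s g). autocorrelation f h) = (\<Sum>c\<in>UNIV. autocorrelation f (c *s g))"
      by (rule sum.reindex[unfolded o_def]) (use g in \<open>auto simp: inj_on_def\<close>)
    also have "\<dots> = autocorrelation f 0 + (\<Sum>c\<in>UNIV-{0}. autocorrelation f (c *s g))"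
      by (subst sum.remove[of UNIV 0]) auto
    also have "\<dots> = Q - 1 + (q - 1) * autocorrelation f g"
      by (simp add: C0 autocorrelation_scale q_def of_nat_diff)
    finally have R: "(\<Sum>h\<in>range (\<lambda>c. c *s g). autocorrelation f h) = Q - 1 + (q - 1) * autocorrelation f g" .
    \<comment> \<open>Both sides evaluate the double sum over hyperplanes: the left from the assumed
      values of \<open>H\<close>, the right through the line spanned by \<open>g\<close>.\<close>
    have "Q * ((q - 1) * (Q - q)) = Q * (0\<^sup>2 + (q - 1) * (Q - 1 + (q - 1) * autocorrelation f g))"
      using sum_hyperplanes_through[OF g, of "autocorrelation f"]
      unfolding sum_autocorrelation sum_homogeneous R q_def[symmetric] Q_def[symmetric] H_def[symmetric] L .
    then have "Q - q = Q - 1 + (q - 1) * autocorrelation f g"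
      using Q0 q3 by simp
    moreover have "(q - 1) * (x + 1) = (Q - 1 + (q - 1) * x) - (Q - q)" for x
      by (simp add: algebra_simps)
    ultimately have "(q - 1) * (autocorrelation f g + 1) = 0"
      by simp
    then have "autocorrelation f g + 1 = 0"
      using q3 by (simp only: mult_eq_0_iff) linarith
    then show "autocorrelation f g = -1"
      by linarith
  qed
  moreover have "q * H w = (q - 1) * Q \<longleftrightarrow> q * (T w)\<^sup>2 = (q - 1)\<^sup>2 * Q" for w
  proof -
    have "q * (T w)\<^sup>2 = (q - 1) * (q * H w)"
      by (simp only: H[symmetric] mult.left_commute)
    moreover have "(q - 1)\<^sup>2 * Q = (q - 1) * ((q - 1) * Q)"
      by (simp only: power2_eq_square mult.assoc)
    ultimately have "q * (T w)\<^sup>2 = (q - 1)\<^sup>2 * Q \<longleftrightarrow> q - 1 = 0 \<or> q * H w = (q - 1) * Q"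
      by (simp only: mult_cancel_left)
    moreover have "q - 1 \<noteq> 0" using q3 by linarith
    ultimately show ?thesis by blast
  qed
  ultimately show ?thesis unfolding q_def Q_def by simp
qed

end

section \<open>The sign function of a choice of orbits\<close>

text \<open>A nonzero vector \<open>v\<close> lies in \<open>orbit (orbit_index v)\<close> or its negative, according to the
  quadratic character of its last nonzero coordinate.\<close>

definition leading_coord :: "'a::field ^ 3 \<Rightarrow> 'a" where
  "leading_coord v = (if v $ 3 \<noteq> 0 then v $ 3 else if v $ 2 \<noteq> 0 then v $ 2 else v $ 1)"

definition orbit_index :: "'a::field ^ 3 \<Rightarrow> 'a index" where
  "orbit_index v = (if v $ 3 \<noteq> 0 then Fin (v $ 1 / v $ 3 - (v $ 2 / v $ 3)\<^sup>2 / 2)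
    else if v $ 2 \<noteq> 0 then Infty else Bullet)"

text \<open>This is the function \<open>f\<close> of the overview. At the origin the index defaults
  to \<open>Bullet\<close>, but the leading coordinate is 0 and so the value is 0.\<close>

definition orbit_sign :: "('a::field index \<Rightarrow> int) \<Rightarrow> 'a ^ 3 \<Rightarrow> int" where
  "orbit_sign \<epsilon> v = quad_char (leading_coord v) * \<epsilon> (orbit_index v)"

lemma leading_coord_scale: "leading_coord (c *s v) = c * leading_coord v"
  by (simp add: leading_coord_def)

lemma orbit_index_scale: "c \<noteq> 0 \<Longrightarrow> orbit_index (c *s v) = orbit_index v"
  by (simp add: orbit_index_def)

lemma leading_coord_eq_0_iff: "leading_coord v = 0 \<longleftrightarrow> v = 0"
  by (auto simp: leading_coord_def vec_eq_iff forall_3)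

text \<open>The orbit parameters can be read off from the coordinates: for a finite index, s is
  \<open>v $ 3\<close> and x is \<open>v $ 2 / v $ 3\<close>, which leaves
  \<open>orbit_index v\<close> as the only possible i.\<close>

lemma mem_orbit_iff: "v \<in> orbit i \<longleftrightarrow> quad_char (leading_coord v) = 1 \<and> orbit_index v = i"
proof (cases i)
  case (Fin j)
  have "v \<in> orbit (Fin j) \<longleftrightarrow> quad_char (v $ 3) = 1 \<and> v $ 1 / v $ 3 - (v $ 2 / v $ 3)\<^sup>2 / 2 = j"
    (is "_ \<longleftrightarrow> ?R")
  proof
    assume ?R
    then have "v $ 3 \<in> nonzero_squares" "v $ 3 \<noteq> 0" "v $ 1 / v $ 3 - (v $ 2 / v $ 3)\<^sup>2 / 2 = j"
      by (auto simp: nonzero_squares_iff)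
    moreover from this have "v = vector [v $ 3 * ((v $ 2 / v $ 3)\<^sup>2 / 2 + j), v $ 3 * (v $ 2 / v $ 3), v $ 3]"
      by (auto simp: vec_eq_iff forall_3)
    ultimately show "v \<in> orbit (Fin j)" unfolding orbit.simps by blast
  qed (auto simp: nonzero_squares_iff)
  then show ?thesis
    by (auto simp: Fin leading_coord_def orbit_index_def)
next
  case Infty
  have "v \<in> orbit Infty \<longleftrightarrow> quad_char (v $ 2) = 1 \<and> v $ 3 = 0"
    by (auto simp: nonzero_squares_iff vec_eq_iff forall_3 vector_3)
  then show ?thesis
    by (auto simp: Infty leading_coord_def orbit_index_def)
next
  case Bullet
  have "v \<in> orbit Bullet \<longleftrightarrow> quad_char (v $ 1) = 1 \<and> v $ 2 = 0 \<and> v $ 3 = 0"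
    by (auto simp: nonzero_squares_iff vec_eq_iff forall_3 vector_3)
  then show ?thesis
    by (auto simp: Bullet leading_coord_def orbit_index_def)
qed

context
  fixes \<epsilon> :: "'a::{field,finite} index \<Rightarrow> int"
  assumes card_mod_4: "CARD('a) mod 4 = 3" and sign: "\<And>i. \<epsilon> i \<in> {1, -1}"
begin

lemma orbit_sign_scale: "orbit_sign \<epsilon> (t *s v) = quad_char t * orbit_sign \<epsilon> v"
  by (cases "t = 0")
     (simp_all add: orbit_sign_def leading_coord_scale orbit_index_scale quad_char_mult[OF card_mod_4]
       leading_coord_def)

lemma orbit_sign_nonzero: "v \<noteq> 0 \<Longrightarrow> orbit_sign \<epsilon> v \<in> {1, -1}"
  using sign[of "orbit_index v"] quad_char_cases[of "leading_coord v"]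
  by (auto simp: orbit_sign_def leading_coord_eq_0_iff)

text \<open>A sign is its own inverse, so \<open>v\<close> lies in the signed orbit iff
  \<open>\<epsilon> i\<close> times \<open>v\<close> lies in \<open>orbit i\<close>; the character
  of that scalar is \<open>\<epsilon> i\<close> itself.\<close>

lemma D_set_eq: "D_set \<epsilon> = {v. orbit_sign \<epsilon> v = 1}"
proof -
  have sq: "of_int (\<epsilon> i) * of_int (\<epsilon> i) = (1::'a)" and nz: "of_int (\<epsilon> i) \<noteq> (0::'a)" for i
    using sign[of i] by auto
  have "v \<in> D_set \<epsilon> \<longleftrightarrow> (\<exists>i. of_int (\<epsilon> i) *s v \<in> orbit i)" for v
  proof
    assume "v \<in> D_set \<epsilon>"
    then obtain i w where "w \<in> orbit i" "v = of_int (\<epsilon> i) *s w" by (auto simp: D_set_def)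
    then have "of_int (\<epsilon> i) *s v \<in> orbit i" by (simp add: sq)
    then show "\<exists>i. of_int (\<epsilon> i) *s v \<in> orbit i" ..
  next
    assume "\<exists>i. of_int (\<epsilon> i) *s v \<in> orbit i"
    then obtain i where "of_int (\<epsilon> i) *s v \<in> orbit i" ..
    moreover have "v = of_int (\<epsilon> i) *s (of_int (\<epsilon> i) *s v)" by (simp add: sq)
    ultimately show "v \<in> D_set \<epsilon>" unfolding D_set_def by blast
  qed
  also have "(\<exists>i. of_int (\<epsilon> i) *s v \<in> orbit i) \<longleftrightarrow> orbit_sign \<epsilon> v = 1" for v
    using quad_char_of_int_sign[OF card_mod_4 sign] nz
    by (auto simp: mem_orbit_iff leading_coord_scale orbit_index_scale orbit_sign_def
        quad_char_mult[OF card_mod_4] mult.commute)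
  finally show ?thesis by blast
qed

section \<open>Explicit evaluation of the transform\<close>

lemma sum_vec3: "(\<Sum>v\<in>UNIV. g (v :: 'a ^ 3)) = (\<Sum>c\<in>UNIV. \<Sum>b\<in>UNIV. \<Sum>a\<in>UNIV. g (vector [a, b, c]))"
  for g :: "'a ^ 3 \<Rightarrow> int"
proof -
  have "(\<Sum>c\<in>UNIV. \<Sum>b\<in>UNIV. \<Sum>a\<in>UNIV. g (vector [a, b, c]))
      = (\<Sum>(c, b, a)\<in>UNIV. g (vector [a, b, c]))"
    by (simp add: sum.cartesian_product)
  also have "\<dots> = (\<Sum>v\<in>UNIV. g v)"
    by (rule sum.reindex_bij_witness[of _ "\<lambda>v. (v $ 3, v $ 2, v $ 1)" "\<lambda>(c, b, a). vector [a, b, c]"])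
       (auto simp: vec_eq_iff forall_3)
  finally show ?thesis ..
qed

text \<open>Letting \<open>s\<close> run over all nonzero elements, not only squares, covers each
  orbit together with its negative. The last sum also admits s = 0, which accounts for the
  origin.\<close>

lemma sum_over_orbits:
  fixes g :: "'a ^ 3 \<Rightarrow> int"
  shows "(\<Sum>v\<in>UNIV. g v) = (\<Sum>s\<in>UNIV-{0}. \<Sum>x\<in>UNIV. \<Sum>i\<in>UNIV. g (vector [s * (x\<^sup>2 / 2 + i), s * x, s]))
    + (\<Sum>s\<in>UNIV-{0}. \<Sum>x\<in>UNIV. g (vector [x, s, 0])) + (\<Sum>s\<in>UNIV. g (vector [s, 0, 0]))"
proof -
  have "(\<Sum>v\<in>UNIV. g v) = (\<Sum>b\<in>UNIV. \<Sum>a\<in>UNIV. g (vector [a, b, 0]))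
      + (\<Sum>c\<in>UNIV-{0}. \<Sum>b\<in>UNIV. \<Sum>a\<in>UNIV. g (vector [a, b, c]))"
    unfolding sum_vec3 by (rule sum.remove) auto
  also have "(\<Sum>b\<in>UNIV. \<Sum>a\<in>UNIV. g (vector [a, b, 0]))
      = (\<Sum>s\<in>UNIV. g (vector [s, 0, 0])) + (\<Sum>s\<in>UNIV-{0}. \<Sum>x\<in>UNIV. g (vector [x, s, 0]))"
    by (rule sum.remove) auto
  also have "(\<Sum>c\<in>UNIV-{0}. \<Sum>b\<in>UNIV. \<Sum>a\<in>UNIV. g (vector [a, b, c]))
      = (\<Sum>s\<in>UNIV-{0}. \<Sum>x\<in>UNIV. \<Sum>i\<in>UNIV. g (vector [s * (x\<^sup>2 / 2 + i), s * x, s]))"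
  proof (rule sum.cong[OF refl])
    fix s :: 'a assume "s \<in> UNIV - {0}"
    then have s: "s \<noteq> 0" by simp
    have "(\<Sum>b\<in>UNIV. \<Sum>a\<in>UNIV. g (vector [a, b, s])) = (\<Sum>x\<in>UNIV. \<Sum>a\<in>UNIV. g (vector [a, s * x, s]))"
      by (rule sum.reindex_bij_witness[of _ "\<lambda>x. s * x" "\<lambda>b. b / s"]) (use s in auto)
    also have "\<dots> = (\<Sum>x\<in>UNIV. \<Sum>i\<in>UNIV. g (vector [s * (x\<^sup>2 / 2 + i), s * x, s]))"
    proof (rule sum.cong[OF refl])
      fix x :: 'a
      show "(\<Sum>a\<in>UNIV. g (vector [a, s * x, s])) = (\<Sum>i\<in>UNIV. g (vector [s * (x\<^sup>2 / 2 + i), s * x, s]))"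
        by (rule sum.reindex_bij_witness[of _ "\<lambda>i. s * (x\<^sup>2 / 2 + i)" "\<lambda>a. a / s - x\<^sup>2 / 2"]) (use s in auto)
    qed
    finally show "(\<Sum>b\<in>UNIV. \<Sum>a\<in>UNIV. g (vector [a, b, s]))
      = (\<Sum>x\<in>UNIV. \<Sum>i\<in>UNIV. g (vector [s * (x\<^sup>2 / 2 + i), s * x, s]))" .
  qed
  finally show ?thesis by simp
qed

lemma dot_vector_3: "dot (vector [a, b, c]) (vector [x, y, z] :: 'a ^ 3) = a * x + b * y + c * (z :: 'a)"
  by (simp add: dot_def sum_3)

lemma sum_nonzero_quad_char_sq: "(\<Sum>s\<in>UNIV-{0}. quad_char (s::'a) * quad_char s * k) = (int CARD('a) - 1) * k"
proof -
  have "(\<Sum>s\<in>UNIV-{0}. quad_char (s::'a) * quad_char s * k) = (\<Sum>s\<in>UNIV-{0::'a}. k)"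
    by (rule sum.cong) (auto simp: quad_char_mult_self)
  then show ?thesis by (simp add: of_nat_diff)
qed

text \<open>On the \<open>Fin\<close> and \<open>Bullet\<close> orbits the scalar \<open>s\<close>
  contributes \<open>quad_char s\<close> twice, once from the sign and once from the form, so
  summing over \<open>s\<close> yields the factor q - 1. The \<open>Infty\<close> term is left
  unevaluated because it depends on whether \<open>a\<close> is 0.\<close>

lemma orbit_sign_transform:
  "(\<Sum>v\<in>UNIV. orbit_sign \<epsilon> v * quad_char (dot (vector [a, b, c]) v))
    = (int CARD('a) - 1) * (\<Sum>i\<in>UNIV. \<epsilon> (Fin i) * (\<Sum>x\<in>UNIV. quad_char (a * (x\<^sup>2 / 2 + i) + b * x + c)))
    + \<epsilon> Infty * (\<Sum>s\<in>UNIV-{0}. quad_char s * (\<Sum>x\<in>UNIV. quad_char (a * x + b * s)))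
    + (int CARD('a) - 1) * (\<epsilon> Bullet * quad_char a)" (is "?L = ?A + ?B + ?C")
proof -
  let ?f = "\<lambda>v. orbit_sign \<epsilon> v * quad_char (dot (vector [a, b, c]) v)"
  have "(\<Sum>x\<in>UNIV. \<Sum>i\<in>UNIV. ?f (vector [s * (x\<^sup>2 / 2 + i), s * x, s]))
      = quad_char s * quad_char s
        * (\<Sum>i\<in>UNIV. \<epsilon> (Fin i) * (\<Sum>x\<in>UNIV. quad_char (a * (x\<^sup>2 / 2 + i) + b * x + c)))"
    if "s \<noteq> 0" for s
  proof -
    have "?f (vector [s * (x\<^sup>2 / 2 + i), s * x, s])
        = quad_char s * quad_char s * (\<epsilon> (Fin i) * quad_char (a * (x\<^sup>2 / 2 + i) + b * x + c))" for x i
    proof -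
      have "dot (vector [a, b, c]) (vector [s * (x\<^sup>2 / 2 + i), s * x, s] :: 'a ^ 3) = s * (a * (x\<^sup>2 / 2 + i) + b * x + c)"
        unfolding dot_vector_3 by (simp add: algebra_simps)
      moreover have "orbit_sign \<epsilon> (vector [s * (x\<^sup>2 / 2 + i), s * x, s]) = quad_char s * \<epsilon> (Fin i)"
        using that by (simp add: orbit_sign_def leading_coord_def orbit_index_def)
      ultimately show ?thesis by (simp only: quad_char_mult[OF card_mod_4] ac_simps)
    qed
    then show ?thesis
      by (subst sum.swap) (simp add: sum_distrib_left)
  qed
  then have "(\<Sum>s\<in>UNIV-{0}. \<Sum>x\<in>UNIV. \<Sum>i\<in>UNIV. ?f (vector [s * (x\<^sup>2 / 2 + i), s * x, s])) = ?A"
    by (simp add: sum_nonzero_quad_char_sq)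
  moreover have "(\<Sum>s\<in>UNIV-{0}. \<Sum>x\<in>UNIV. ?f (vector [x, s, 0])) = ?B"
    by (simp add: sum_distrib_left dot_vector_3 orbit_sign_def leading_coord_def orbit_index_def ac_simps)
  moreover have "(\<Sum>s\<in>UNIV. ?f (vector [s, 0, 0])) = ?C"
  proof -
    have "(\<Sum>s\<in>UNIV. ?f (vector [s, 0, 0])) = (\<Sum>s\<in>(UNIV::'a set). quad_char s * quad_char s * (\<epsilon> Bullet * quad_char a))"
      by (intro sum.cong refl) (simp add: dot_vector_3 orbit_sign_def leading_coord_def orbit_index_def
          quad_char_mult[OF card_mod_4])
    also have "\<dots> = (\<Sum>s\<in>UNIV-{0::'a}. quad_char s * quad_char s * (\<epsilon> Bullet * quad_char a))"
      by (rule sum.mono_neutral_right) auto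
    finally show ?thesis by (simp only: sum_nonzero_quad_char_sq)
  qed
  ultimately show ?thesis by (simp only: sum_over_orbits)
qed

text \<open>Completing the square gives (a/2)((x + b/a)^2 + 2(i - d)) with d = (b/a)^2/2 - c/a,
  which reduces the sum to \<open>sum_quad_char_square_add\<close>.\<close>

lemma sum_quad_char_quadratic:
  fixes a b c i :: 'a
  assumes a: "a \<noteq> 0"
  shows "(\<Sum>x\<in>UNIV. quad_char (a * (x\<^sup>2 / 2 + i) + b * x + c))
    = quad_char a * quad_char (2::'a) * (if i = (b / a)\<^sup>2 / 2 - c / a then int CARD('a) - 1 else -1)"
proof -
  note two = two_neq_0[OF card_mod_4]
  have four: "(4::'a) \<noteq> 0"
    using two mult_eq_0_iff[of "2::'a" 2] by simp
  obtain b' c' where bc: "b = a * b'" "c = a * c'"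
    using a that[of "b / a" "c / a"] by simp
  define d where "d = b'\<^sup>2 / 2 - c'"
  have "(\<Sum>x\<in>UNIV. quad_char (a * (x\<^sup>2 / 2 + i) + b * x + c))
      = (\<Sum>y\<in>UNIV. quad_char (a / 2 * (y\<^sup>2 + 2 * (i - d))))"
  proof (rule sum.reindex_bij_witness[of _ "\<lambda>y. y - b'" "\<lambda>x. x + b'"])
    fix x
    have "a / 2 * ((x + b')\<^sup>2 + 2 * (i - d)) = a * (x\<^sup>2 / 2 + i) + b * x + c"
      using two four by (simp add: d_def bc power2_eq_square field_simps)
    then show "quad_char (a / 2 * ((x + b')\<^sup>2 + 2 * (i - d))) = quad_char (a * (x\<^sup>2 / 2 + i) + b * x + c)"
      by (rule arg_cong)
  qed auto
  also have "\<dots> = quad_char a * quad_char (2::'a) * (\<Sum>y\<in>UNIV. quad_char (y\<^sup>2 + 2 * (i - d)))"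
    by (simp only: quad_char_mult[OF card_mod_4] quad_char_divide[OF card_mod_4] sum_distrib_left)
  also have "(\<Sum>y\<in>UNIV. quad_char (y\<^sup>2 + 2 * (i - d))) = (if i = d then int CARD('a) - 1 else -1)"
    using two by (simp add: sum_quad_char_square_add[OF card_mod_4])
  finally show ?thesis using a by (simp add: d_def bc)
qed

text \<open>The single index i = d has inner sum proportional to q - 1 and all others to -1, which
  combine to q \<open>\<epsilon> (Fin d)\<close> minus the total. The \<open>Infty\<close> term is
  an affine character sum and vanishes.\<close>

lemma orbit_sign_transform_generic:
  assumes "a \<noteq> 0"
  shows "(\<Sum>v\<in>UNIV. orbit_sign \<epsilon> v * quad_char (dot (vector [a, b, c]) v))
    = (int CARD('a) - 1) * quad_char a * (quad_char (2::'a)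
        * (int CARD('a) * \<epsilon> (Fin ((b / a)\<^sup>2 / 2 - c / a)) - (\<Sum>i\<in>UNIV. \<epsilon> (Fin i))) + \<epsilon> Bullet)"
proof -
  define d where "d = (b / a)\<^sup>2 / 2 - c / a"
  have "(\<Sum>i\<in>UNIV. \<epsilon> (Fin i) * (\<Sum>x\<in>UNIV. quad_char (a * (x\<^sup>2 / 2 + i) + b * x + c)))
      = (\<Sum>i\<in>UNIV. quad_char a * quad_char (2::'a) * ((if i = d then int CARD('a) * \<epsilon> (Fin i) else 0) - \<epsilon> (Fin i)))"
    by (rule sum.cong) (simp_all only: sum_quad_char_quadratic[OF assms] d_def[symmetric], auto simp: algebra_simps)
  also have "\<dots> = quad_char a * quad_char (2::'a) * (int CARD('a) * \<epsilon> (Fin d) - (\<Sum>i\<in>UNIV. \<epsilon> (Fin i)))"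
    by (simp add: sum_subtractf flip: sum_distrib_left)
  finally show ?thesis
    unfolding orbit_sign_transform d_def[symmetric] sum_quad_char_affine[OF card_mod_4 assms]
    by (simp only:) (simp add: algebra_simps)
qed

lemma orbit_sign_transform_0_nonzero:
  assumes "b \<noteq> 0"
  shows "(\<Sum>v\<in>UNIV. orbit_sign \<epsilon> v * quad_char (dot (vector [0, b, c]) v))
    = (int CARD('a) - 1) * (int CARD('a) * (\<epsilon> Infty * quad_char b))"
proof -
  have "(\<Sum>s\<in>UNIV-{0}. quad_char s * (\<Sum>x\<in>(UNIV::'a set). quad_char (0 * x + b * s)))
      = (\<Sum>s\<in>UNIV-{0::'a}. quad_char s * quad_char s * (int CARD('a) * quad_char b))"
    by (intro sum.cong refl) (simp add: quad_char_mult[OF card_mod_4])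
  then show ?thesis
    unfolding orbit_sign_transform sum_nonzero_quad_char_sq
    by (simp add: sum_quad_char_affine[OF card_mod_4 assms])
qed

lemma orbit_sign_transform_0_0:
  "(\<Sum>v\<in>UNIV. orbit_sign \<epsilon> v * quad_char (dot (vector [0, 0, c]) v))
    = (int CARD('a) - 1) * (int CARD('a) * ((\<Sum>i\<in>UNIV. \<epsilon> (Fin i)) * quad_char c))"
  unfolding orbit_sign_transform by (simp add: sum_distrib_left sum_distrib_right ac_simps)

theorem skew_Hadamard_D_set_iff:
  "skew_Hadamard_difference_set (D_set \<epsilon>) \<longleftrightarrow> (\<Sum>i\<in>UNIV. \<epsilon> (Fin i)) = quad_char (2::'a) * \<epsilon> Bullet"
proof -
  define q S h where "q = int CARD('a)" and "S = (\<Sum>i\<in>UNIV. \<epsilon> (Fin i))" and "h = quad_char (2::'a)"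
  define T where "T w = (\<Sum>v\<in>UNIV. orbit_sign \<epsilon> v * quad_char (dot w v))" for w
  have q3: "q \<ge> 3" using card_mod_4 unfolding q_def by (cases "CARD('a) \<ge> 3") auto
  have h: "h * h = 1" using two_neq_0[OF card_mod_4] by (simp add: h_def quad_char_mult_self)
  have sq: "\<epsilon> i * \<epsilon> i = 1" for i using sign[of i] by auto
  have "CARD('a ^ 3) mod 4 = (CARD('a) mod 4) ^ 3 mod 4"
    by (simp add: power_mod)
  then have card3: "CARD('a ^ 3) mod 4 = 3"
    unfolding card_mod_4 by simp
  have odd: "orbit_sign \<epsilon> (- v) = - orbit_sign \<epsilon> v" for v
    using orbit_sign_scale[of "-1" v] quad_char_minus[OF card_mod_4, of 1] by simp
  have "skew_Hadamard_difference_set (D_set \<epsilon>) \<longleftrightarrow> (\<forall>w. w \<noteq> 0 \<longrightarrow> q * (T w)\<^sup>2 = (q - 1)\<^sup>2 * q ^ 3)"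
    using skew_Hadamard_iff_autocorrelation[of "orbit_sign \<epsilon>", OF orbit_sign_nonzero odd card3]
      autocorrelation_eq_minus_one_iff[where f = "orbit_sign \<epsilon>", OF card_mod_4 orbit_sign_scale orbit_sign_nonzero]
    by (simp add: D_set_eq q_def T_def)
  also have "\<dots> \<longleftrightarrow> (\<forall>a b c. (a, b, c) \<noteq> (0, 0, 0) \<longrightarrow> q * (T (vector [a, b, c]))\<^sup>2 = (q - 1)\<^sup>2 * q ^ 3)"
    by (subst forall_vector_3) (simp add: vec_eq_iff forall_3)
  also have "\<dots> \<longleftrightarrow> (\<forall>d. (h * (q * \<epsilon> (Fin d) - S) + \<epsilon> Bullet)\<^sup>2 = q\<^sup>2) \<and> S\<^sup>2 = 1"
  proof -
    \<comment> \<open>Each of the three transform formulas has the shape (q - 1) X, so the common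
      factor q (q - 1)^2 cancels.\<close>
    have *: "q * ((q - 1) * X)\<^sup>2 = (q - 1)\<^sup>2 * q ^ 3 \<longleftrightarrow> X\<^sup>2 = q\<^sup>2" for X
    proof -
      have "q * ((q - 1) * X)\<^sup>2 = (q * (q - 1)\<^sup>2) * X\<^sup>2" "(q - 1)\<^sup>2 * q ^ 3 = (q * (q - 1)\<^sup>2) * q\<^sup>2"
        by (simp_all add: power2_eq_square power3_eq_cube)
      then show ?thesis using q3 by simp
    qed
    have A: "q * (T (vector [a, b, c]))\<^sup>2 = (q - 1)\<^sup>2 * q ^ 3
        \<longleftrightarrow> (h * (q * \<epsilon> (Fin ((b / a)\<^sup>2 / 2 - c / a)) - S) + \<epsilon> Bullet)\<^sup>2 = q\<^sup>2" if "a \<noteq> 0" for a b c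
    proof -
      have "(quad_char a)\<^sup>2 = 1" using that by (simp add: power2_eq_square quad_char_mult_self)
      then show ?thesis
        unfolding T_def orbit_sign_transform_generic[OF that] q_def[symmetric] S_def[symmetric] h_def[symmetric]
          mult.assoc * by (simp add: power_mult_distrib)
    qed
    have B: "q * (T (vector [0, b, c]))\<^sup>2 = (q - 1)\<^sup>2 * q ^ 3" if "b \<noteq> 0" for b c
      unfolding T_def orbit_sign_transform_0_nonzero[OF that] q_def[symmetric] *
      using that by (simp add: power2_eq_square sq quad_char_mult_self ac_simps)
    have C: "q * (T (vector [0, 0, c]))\<^sup>2 = (q - 1)\<^sup>2 * q ^ 3 \<longleftrightarrow> S\<^sup>2 = 1" if "c \<noteq> 0" for c
    proof -
      have "(quad_char c)\<^sup>2 = 1" using that by (simp add: power2_eq_square quad_char_mult_self)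
      then show ?thesis
        unfolding T_def orbit_sign_transform_0_0 q_def[symmetric] S_def[symmetric] *
        using q3 by (simp add: power_mult_distrib)
    qed
    show ?thesis
    proof (intro iffI conjI allI impI)
      fix d
      assume "\<forall>a b c. (a, b, c) \<noteq> (0, 0, 0) \<longrightarrow> q * (T (vector [a, b, c]))\<^sup>2 = (q - 1)\<^sup>2 * q ^ 3"
      \<comment> \<open>The vector (1, 0, -d) realizes the prescribed index
        \<open>d\<close>.\<close>
      then show "(h * (q * \<epsilon> (Fin d) - S) + \<epsilon> Bullet)\<^sup>2 = q\<^sup>2"
        using A[of 1 0 "- d"] by simp
    next
      assume "\<forall>a b c. (a, b, c) \<noteq> (0, 0, 0) \<longrightarrow> q * (T (vector [a, b, c]))\<^sup>2 = (q - 1)\<^sup>2 * q ^ 3"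
      then show "S\<^sup>2 = 1" using C[of 1] by simp
    next
      fix a b c :: 'a
      assume "(\<forall>d. (h * (q * \<epsilon> (Fin d) - S) + \<epsilon> Bullet)\<^sup>2 = q\<^sup>2) \<and> S\<^sup>2 = 1"
        and "(a, b, c) \<noteq> (0, 0, 0 :: 'a)"
      then show "q * (T (vector [a, b, c]))\<^sup>2 = (q - 1)\<^sup>2 * q ^ 3"
        using A[of a b c] B[of b c] C[of c] by (cases "a = 0"; cases "b = 0") auto
    qed
  qed
  also have "\<dots> \<longleftrightarrow> S = h * \<epsilon> Bullet"
  proof
    \<comment> \<open>Up to sign the expression is q plus or minus the defect
      \<open>\<epsilon> Bullet - h * S\<close>. The defect is at most 2 in absolute value while the
      two admissible values q and -q are at least 6 apart, so it is 0. One index is enough.\<close>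
    assume *: "(\<forall>d. (h * (q * \<epsilon> (Fin d) - S) + \<epsilon> Bullet)\<^sup>2 = q\<^sup>2) \<and> S\<^sup>2 = 1"
    have "h = 1 \<or> h = -1" using h zmult_eq_1_iff by auto
    moreover have "S = 1 \<or> S = -1" using * by (simp add: power2_eq_1_iff)
    moreover have "(h * (q * \<epsilon> (Fin 0) - S) + \<epsilon> Bullet)\<^sup>2 = q\<^sup>2" using * by blast
    then have "h * (q * \<epsilon> (Fin 0) - S) + \<epsilon> Bullet = q \<or> h * (q * \<epsilon> (Fin 0) - S) + \<epsilon> Bullet = - q"
      by (simp add: power2_eq_iff)
    ultimately show "S = h * \<epsilon> Bullet"
      using sign[of "Fin 0"] sign[of Bullet] q3 by auto
  next
    assume S: "S = h * \<epsilon> Bullet"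
    \<comment> \<open>As h^2 = 1, the defect \<open>\<epsilon> Bullet - h * S\<close> vanishes, so
      only a signed q remains for every \<open>d\<close>.\<close>
    have "h * S = h * h * \<epsilon> Bullet" unfolding S by (simp only: mult.assoc)
    then have "h * (q * \<epsilon> (Fin d) - S) + \<epsilon> Bullet = q * (h * \<epsilon> (Fin d))" for d
      by (simp add: h right_diff_distrib)
    moreover have "S\<^sup>2 = (h * h) * (\<epsilon> Bullet * \<epsilon> Bullet)"
      unfolding S power2_eq_square by (simp only: ac_simps)
    moreover have "(q * (h * \<epsilon> (Fin d)))\<^sup>2 = q\<^sup>2 * ((h * h) * (\<epsilon> (Fin d) * \<epsilon> (Fin d)))" for d
      unfolding power2_eq_square by (simp only: ac_simps)
    ultimately show "(\<forall>d. (h * (q * \<epsilon> (Fin d) - S) + \<epsilon> Bullet)\<^sup>2 = q\<^sup>2) \<and> S\<^sup>2 = 1"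
      by (simp add: h sq)
  qed
  finally show ?thesis unfolding S_def h_def .
qed

section \<open>From the sign sum to the cardinality and the Legendre symbol\<close>

lemma sum_Fin_eq: "(\<Sum>i\<in>UNIV. \<epsilon> (Fin i)) = 2 * int (card (J_set \<epsilon>)) - int CARD('a)"
proof -
  have "(\<Sum>i\<in>UNIV. \<epsilon> (Fin i)) = (\<Sum>i\<in>UNIV. 2 * (if i \<in> J_set \<epsilon> then 1 else 0) - 1)"
    using sign by (intro sum.cong refl) (force simp: J_set_def)
  then show ?thesis by (simp add: sum_subtractf sum.If_cases flip: sum_distrib_left)
qed

end

theorem theorem5p2:
  fixes p n q :: nat
    and \<epsilon> :: "'a::{field,finite} index \<Rightarrow> int"
  assumes "prime p" and "[p = 3] (mod 4)" and "odd n" and "q = p ^ n"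
    and "CARD('a) = q"
    and "\<And>i. \<epsilon> i \<in> {1, -1}"
  shows "skew_Hadamard_difference_set (D_set \<epsilon>) \<longleftrightarrow>
    (\<exists>\<mu>\<in>{1, -1 :: int}.
       real (card (J_set \<epsilon>)) = (real q + of_int \<mu>) / 2 \<and>
       \<epsilon> Bullet = Legendre 2 (int p) * \<mu>)"
proof -
  have card: "CARD('a) = p ^ n" using assms by simp
  note qc = quad_char_two[OF assms(1,2) card assms(3)]
  define L S where "L = Legendre 2 (int p)" and "S = (\<Sum>i\<in>UNIV. \<epsilon> (Fin i))"
  have "L = 1 \<or> L = -1"
    using qc(2) two_neq_0[OF qc(1)] quad_char_cases[of "2::'a"] unfolding L_def by auto
  have mu: "real (card (J_set \<epsilon>)) = (real q + of_int \<mu>) / 2 \<longleftrightarrow> S = \<mu>" for \<mu>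
  proof -
    have "real (card (J_set \<epsilon>)) = (real q + of_int \<mu>) / 2
        \<longleftrightarrow> real_of_int (2 * int (card (J_set \<epsilon>)) - int q) = of_int \<mu>"
      by auto
    also have "\<dots> \<longleftrightarrow> S = \<mu>"
      unfolding S_def sum_Fin_eq[of \<epsilon>, OF qc(1) assms(6)] assms(5) of_int_eq_iff ..
    finally show ?thesis .
  qed
  have "skew_Hadamard_difference_set (D_set \<epsilon>) \<longleftrightarrow> S = L * \<epsilon> Bullet"
    using skew_Hadamard_D_set_iff[of \<epsilon>, OF qc(1) assms(6)] unfolding S_def L_def qc(2) .
  \<comment> \<open>The witness is \<mu> = \<open>S\<close>; since \<open>L\<close> is a sign, it
    can be moved to the other side of the equation.\<close>
  also have "\<dots> \<longleftrightarrow> (\<exists>\<mu>\<in>{1, -1}. S = \<mu> \<and> \<epsilon> Bullet = L * \<mu>)"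
    using \<open>L = 1 \<or> L = -1\<close> assms(6)[of Bullet] by auto
  finally show ?thesis unfolding mu L_def .
qed

end
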